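(* Consider the two-stage stochastic linear program $(P)$: $\min_{x\in\mathcal X}\{c^\top x+q(x)\}$, with optimal value $z^*$ and optimal solution set $\mathcal S^*$, and let $(\hat x^\ell)_{\ell\ge1}$ be the iterates generated by the adaptive sequential SAA algorithm described in the context. Suppose the following. (1) $\mathcal X$ is compact and $(P)$ has relatively complete recourse: $\mathbb P\{\{y\in\mathbb R^{n_2}_+: W(\xi)y\ge h(\xi)-T(\xi)x\}=\emptyset\}=0$ for all $x\in\mathcal X$. (2) For all $\ell\ge1$, $\sup_{x\in\mathcal X}\mathrm{Var}(Q(x,\xi^\ell)\mid\mathcal F_{\ell-1})<\infty$ a.s., and there is a constant $\kappa_0<\infty$ such that for all $\ell\ge1$ (and all sample sizes $m$), $\mathbb E\big[\sup_{x\in\mathcal X}|Q^\ell_m(x)-q(x)|^2\mid\mathcal F_{\ell-1}\big]\le\kappa_0/m$ a.s. (3) (Solver condition) For every $\ell\ge 1$ there is an $\mathcal F_\ell$-measurable random variable $\Lambda_\ell$ such that the solver, executed on $(P_\ell)$ from the initial solution $\hat x^{\ell-1}\in\mathcal X$, satisfies $$c^\top\hat x^{\ell,t}+Q^\ell_{m_\ell}(\hat x^{\ell,t})-z^*_{m_\ell}\le\Lambda_\ell\,\frac{\mathrm{dist}(\hat x^{\ell-1},\mathcal S^*_{m_\ell})}{\sqrt t},\qquad t=1,2,\dots,$$ and, with $\gamma_\ell:=\sup\{s: c^\top x+Q^\ell_{m_\ell}(x)-z^*_{m_\ell}\ge s\,\mathrm{dist}(x,\mathcal S^*_{m_\ell})\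 \ \forall x\in\mathcal X\}$, there is a constant $\lambda<\infty$ with $\mathbb E[(\Lambda_\ell/\gamma_\ell)^2\mid\mathcal F_{\ell-1}]\le\lambda^2$ a.s. for all $\ell$. (4) The sample sizes increase geometrically: $m_\ell=c_1m_{\ell-1}$ for $\ell\ge2$, with $c_1\in(1,\infty)$. Let $\tilde W_\ell$ be the number of second-stage linear programs solved during the $\ell$-th outer iteration and $W_L:=\sum_{\ell=1}^L\tilde W_\ell$. Then there is a constant $\tau_0$ independent of $L$ such that for all $L\ge1$, $$\mathbb E\big[c^\top\hat x^L+q(\hat x^L)-z^*\big]\le\frac{\tau_0}{\mathbb E[\sqrt{W_L}]}.$$ If in addition $\gamma_0:=\sup\{s: c^\top x+q(x)-z^*\ge s\,\mathrm{dist}(x,\mathcal S^* )\ \ \forall x\in\mathcal X\}>0$, then (with the same $\tau_0$) for all $L\ge1$, $$\mathbb E\big[\mathrm{dist}(\hat x^L,\mathcal S^* )\big]\le\frac{\tau_0\,\gamma_0^{-1}}{\mathbb E[\sqrt{W_L}]}.$$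
   Context: Two-stage stochastic linear program: $\mathcal X=\{x\in\mathbb R^{n_1}_+: Ax=b\}$ with $A,b,c$ fixed; $\xi$ is a random element of $\Xi$ with law $P$; $Q(x,\xi)=\min_{y\in\mathbb R^{n_2}_+}\{d(\xi)^\top y: W(\xi)y\ge h(\xi)-T(\xi)x\}$ (the second-stage linear program), assumed $>-\infty$ for all $x\in\mathcal X$, $\xi\in\Xi$; $q(x)=\mathbb E[Q(x,\xi)]$. Sampling: there is a filtered probability space $(\Omega,\mathcal F,(\mathcal F_\ell)_{\ell\ge1},\mathbb P)$. In (outer) iteration $\ell$ one generates identically distributed (not necessarily independent), $\mathcal F_\ell$-measurable scenarios $\xi^\ell_1,\xi^\ell_2,\dots$ ($\xi^\ell$ is a generic one) and sets $Q^\ell_m(x)=m^{-1}\sum_{j=1}^mQ(x,\xi^\ell_j)$. The deterministic sample size used in iteration $\ell$ is $m_\ell\ge1$ (non-integrality of the geometric sequence is disregarded, i.e. the relation is taken to hold exactly). The sample-path problem $(P_\ell)$ is $\min_{x\in\mathcal X}\{c^\top x+Q^\ell_{m_\ell}(x)\}$, with optimal value $z^*_{m_\ell}$ and optimal solution set $\mathcal S^*_{m_\ell}$. Algorithm: fix $\hat x^0\in\mathcal X$ and constants $\nu>0$, $0<\sigma_{\min}<\sigma_{\max}<\infty$. In outer iteration $\ell$, an iterative solver applied to $(P_\ell)$ started from $\hat x^{\ell-1}$ produces points $\hat x^{\ell,t}\in\mathcal X$, $t=1,2,\dots$ (inner iterations), and is stopped once the (estimated, from above) optimality gap of $\hat x^{\ell,t}$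 for $(P_\ell)$ is at most $\epsilon_{\ell,t}:=\nu\,m_\ell^{-1/2}\,\mathrm{proj}(\hat\sigma_{\ell,t},[\sigma_{\min},\sigma_{\max}])$, where $\hat\sigma_{\ell,t}^2=m_\ell^{-1}\sum_{i=1}^{m_\ell}[Q(\hat x^{\ell,t},\xi^\ell_i)-Q^\ell_{m_\ell}(\hat x^{\ell,t})]^2$ and $\mathrm{proj}(\cdot,[a,b])$ is projection onto $[a,b]$. The output is $\hat x^\ell:=\hat x^{\ell,t}$, which is $\mathcal F_\ell$-measurable, and $\epsilon_\ell:=\epsilon_{\ell,t}$ for the stopping index $t$; thus $\hat x^\ell\in\mathcal X$ is $\epsilon_\ell$-optimal for $(P_\ell)$. Work accounting: each inner iteration of outer iteration $\ell$ solves (up to) $m_\ell$ second-stage linear programs, one per scenario, so $\tilde W_\ell=N_\ell m_\ell$, where $N_\ell$ is the number of inner iterations the solver needs to solve $(P_\ell)$ to within optimality gap $\epsilon_\ell$ starting at $\hat x^{\ell-1}$: $N_\ell=\inf\{\bar t\in\{1,2,\dots\}: c^\top\hat x^{\ell,t}+Q^\ell_{m_\ell}(\hat x^{\ell,t})-z^*_{m_\ell}\le\epsilon_\ell\ \text{for all }t\ge\bar t\}$ (each outer iteration contains at least one inner iteration). $\mathrm{dist}(x,S)=\inf\{\|x-z\|_2:z\in S\}$; if a growth constant is $+\infty$ its reciprocal is read as $0$. *)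

theory Defs
  imports "HOL-Probability.Probability"
begin

definition first_stage_feasible :: "real^'n1^'m1 \<Rightarrow> real^'m1 \<Rightarrow> (real^'n1) set" where
  "first_stage_feasible A b = {x. 0 \<le> x \<and> A *v x = b}"

definition second_stage_feasible ::
    "('s \<Rightarrow> real^'n2^'m2) \<Rightarrow> ('s \<Rightarrow> real^'n1^'m2) \<Rightarrow> ('s \<Rightarrow> real^'m2) \<Rightarrow> real^'n1 \<Rightarrow> 's \<Rightarrow> (real^'n2) set"
  where
  "second_stage_feasible W T h x s = {y. 0 \<le> y \<and> W s *v y \<ge> h s - T s *v x}"

text \<open>The value of the second-stage linear program is extended-real valued: it is \<open>\<infinity>\<close> for an
  infeasible program. For a feasible program that is bounded below the infimum is attained.\<close>

definition recourse_value ::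
    "('s \<Rightarrow> real^'n2) \<Rightarrow> ('s \<Rightarrow> real^'n2^'m2) \<Rightarrow> ('s \<Rightarrow> real^'n1^'m2) \<Rightarrow> ('s \<Rightarrow> real^'m2)
      \<Rightarrow> real^'n1 \<Rightarrow> 's \<Rightarrow> ereal"
  where
  "recourse_value d W T h x s = (INF y\<in>second_stage_feasible W T h x s. ereal (d s \<bullet> y))"

text \<open>\<open>E[f] = E[f\<^sup>+] - E[f\<^sup>-]\<close>. Note that \<open>\<infinity> - \<infinity> = \<infinity>\<close> in type \<^typ>\<open>ereal\<close>, so a finite value means
  that both parts are finite, i.e. that a measurable \<open>f\<close> is integrable.\<close>

definition ereal_expectation :: "'a measure \<Rightarrow> ('a \<Rightarrow> ereal) \<Rightarrow> ereal" where
  "ereal_expectation M f =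
     enn2ereal (\<integral>\<^sup>+\<omega>. e2ennreal (f \<omega>) \<partial>M) - enn2ereal (\<integral>\<^sup>+\<omega>. e2ennreal (- f \<omega>) \<partial>M)"

definition cond_variance :: "'a measure \<Rightarrow> 'a measure \<Rightarrow> ('a \<Rightarrow> real) \<Rightarrow> 'a \<Rightarrow> ennreal" where
  "cond_variance M G Y = nn_cond_exp M G (\<lambda>\<omega>. ennreal ((Y \<omega> - real_cond_exp M G Y \<omega>)\<^sup>2))"

definition sample_mean :: "('x \<Rightarrow> 's \<Rightarrow> ereal) \<Rightarrow> (nat \<Rightarrow> 's) \<Rightarrow> nat \<Rightarrow> 'x \<Rightarrow> ereal" where
  "sample_mean Q s k x = (\<Sum>j = 1..k. Q x (s j)) / ereal (real k)"

text \<open>Sample standard deviation; the conversion to \<^typ>\<open>real\<close> only matters if one of the sampled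
  programs is infeasible.\<close>

definition sample_std :: "('x \<Rightarrow> 's \<Rightarrow> ereal) \<Rightarrow> (nat \<Rightarrow> 's) \<Rightarrow> nat \<Rightarrow> 'x \<Rightarrow> real" where
  "sample_std Q s k x =
     sqrt ((\<Sum>i = 1..k. (real_of_ereal (Q x (s i)) - real_of_ereal (sample_mean Q s k x))\<^sup>2) / real k)"

definition opt_value :: "'x set \<Rightarrow> ('x \<Rightarrow> ereal) \<Rightarrow> ereal" where
  "opt_value X f = (INF x\<in>X. f x)"

definition opt_set :: "'x set \<Rightarrow> ('x \<Rightarrow> ereal) \<Rightarrow> 'x set" where
  "opt_set X f = {x \<in> X. f x = opt_value X f}"

definition opt_gap :: "'x set \<Rightarrow> ('x \<Rightarrow> ereal) \<Rightarrow> 'x \<Rightarrow> ereal" where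
  "opt_gap X f x = f x - opt_value X f"

text \<open>The supremum is taken in \<^typ>\<open>ereal\<close>, so the growth constant is \<open>\<infinity>\<close> if the set of admissible
  slopes is unbounded, and then its reciprocal is \<open>0\<close>.\<close>

definition growth_constant :: "'x::metric_space set \<Rightarrow> ('x \<Rightarrow> ereal) \<Rightarrow> ereal" where
  "growth_constant X f =
     (SUP s\<in>{s::real. \<forall>x\<in>X. opt_gap X f x \<ge> ereal (s * infdist x (opt_set X f))}. ereal s)"

text \<open>Number of inner iterations after which the sequence \<open>x 1, x 2, \<dots>\<close> stays within optimality gap
  \<open>e\<close>; it is \<open>\<infinity>\<close> if there is no such number.\<close>

definition iterations_needed :: "'x set \<Rightarrow> ('x \<Rightarrow> ereal) \<Rightarrow> real \<Rightarrow> (nat \<Rightarrow> 'x) \<Rightarrow> enat" where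
  "iterations_needed X f e x =
     Inf (enat ` {n. n \<ge> 1 \<and> (\<forall>t\<ge>n. opt_gap X f (x t) \<le> ereal e)})"

definition enat_sqrt :: "enat \<Rightarrow> ereal" where
  "enat_sqrt n = (case n of enat k \<Rightarrow> ereal (sqrt (real k)) | \<infinity> \<Rightarrow> \<infinity>)"

end

theory Submission
  imports Defs
begin

text \<open>Let \<open>D l\<close> be the uniform error of the sample average in outer iteration \<open>l\<close>, so that
  \<open>E (D l)\<^sup>2\<close> is of order \<open>1 / m l\<close>. Passing between the true and the sampled objective costs at most
  \<open>2 * D l\<close> of optimality gap, hence the output \<open>xout l\<close> has an expected true gap of order
  \<open>1 / sqrt (m l)\<close>. The gap of the starting point \<open>xout (l - 1)\<close> for the \<open>l\<close>-th sampled problem is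
  then of the order of the tolerance \<open>\<epsilon> l\<close>; dividing by \<open>\<gamma> l\<close> bounds its distance to the sampled
  solution set, and the solver condition gives \<open>sqrt (N l) \<le> 1 + \<bar>\<Lambda> l / \<gamma> l\<bar> * gap / \<epsilon> l\<close>. The product
  is split by \<open>2 r s \<le> r\<^sup>2 + s\<^sup>2\<close>, so \<open>E (sqrt (N l))\<close> is bounded uniformly in \<open>l\<close>. As \<open>m\<close> grows
  geometrically, \<open>E (sqrt (work L))\<close> is of order \<open>\<Sum>l\<le>L. sqrt (m l)\<close>, that is, of order \<open>sqrt (m L)\<close>.\<close>

section \<open>Optimality gaps of perturbed extended-real objectives\<close>

lemma opt_value_le: "x \<in> X \<Longrightarrow> opt_value X f \<le> f x"
  by (simp add: opt_value_def INF_lower)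

lemma opt_gap_nonneg:
  assumes "x \<in> X"
  shows "0 \<le> opt_gap X f x"
  using opt_value_le[OF assms, of f] unfolding opt_gap_def
  by (cases "f x"; cases "opt_value X f") auto

text \<open>The value at \<open>x\<close> and the infimum each move by at most \<open>D\<close>. As
  \<open>\<infinity> - \<infinity> = \<infinity>\<close>, closeness makes both objectives finite on
  \<open>X\<close>, so real arithmetic applies.\<close>

lemma opt_gap_perturb:
  fixes f g :: "'x \<Rightarrow> ereal"
  assumes x: "x \<in> X" and close: "\<And>y. y \<in> X \<Longrightarrow> \<bar>f y - g y\<bar> \<le> ereal D"
    and gap: "opt_gap X g x \<le> ereal a"
  shows "opt_gap X f x \<le> ereal (a + 2 * D)"
proof -
  have fin: "\<exists>u v. f y = ereal u \<and> g y = ereal v \<and> \<bar>u - v\<bar> \<le> D" if "y \<in> X" for y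
    using close[OF that] by (cases "f y"; cases "g y") auto
  obtain u v where uv: "f x = ereal u" "g x = ereal v" "\<bar>u - v\<bar> \<le> D" using fin[OF x] by blast
  obtain w where w: "opt_value X g = ereal w" "v - w \<le> a"
    using gap opt_value_le[OF x, of g] uv unfolding opt_gap_def
    by (cases "opt_value X g") auto
  have "ereal (w - D) \<le> opt_value X f" unfolding opt_value_def
  proof (rule INF_greatest)
    fix y assume y: "y \<in> X"
    show "ereal (w - D) \<le> f y" using fin[OF y] opt_value_le[OF y, of g] w by auto
  qed
  then show ?thesis using opt_value_le[OF x, of f] uv w unfolding opt_gap_def
    by (cases "opt_value X f") auto
qed

text \<open>A bounded gap at a point of finite value excludes the optimal value
  \<open>-\<infinity>\<close>, and this carries over to every other point of finite value.\<close>

lemma opt_gap_finite_transfer: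
  fixes f :: "'x \<Rightarrow> ereal"
  assumes "x \<in> X" "y \<in> X" "\<bar>f x\<bar> \<noteq> \<infinity>" "\<bar>f y\<bar> \<noteq> \<infinity>" "opt_gap X f x \<le> ereal a"
  shows "\<exists>g. opt_gap X f y \<le> ereal g"
  using assms opt_value_le[OF assms(1), of f] unfolding opt_gap_def
  by (cases "opt_value X f"; cases "f x"; cases "f y") auto

text \<open>A finite bound on the square rules out infinite \<open>u\<close> and \<open>v\<close>,
  again by \<open>\<infinity> - \<infinity> = \<infinity>\<close>. Both orders of the difference are
  recorded because gaps pass from the true to the sampled problem and back.\<close>

lemma abs_diff_le_sqrt_ereal:
  fixes u v :: ereal
  assumes "\<bar>u - v\<bar>\<^sup>2 \<le> ereal S"
  shows "\<bar>(ereal c + u) - (ereal c + v)\<bar> \<le> ereal (sqrt S)"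
    and "\<bar>(ereal c + v) - (ereal c + u)\<bar> \<le> ereal (sqrt S)"
    and "\<bar>v\<bar> \<noteq> \<infinity>"
proof -
  obtain a b where ab: "u = ereal a" "v = ereal b"
    using assms by (cases u; cases v) (auto simp: power2_eq_square)
  have "\<bar>a - b\<bar>\<^sup>2 \<le> S" using assms ab by (simp add: power2_eq_square)
  then have "\<bar>a - b\<bar> \<le> sqrt S" by (rule real_le_rsqrt)
  then show "\<bar>(ereal c + u) - (ereal c + v)\<bar> \<le> ereal (sqrt S)"
    "\<bar>(ereal c + v) - (ereal c + u)\<bar> \<le> ereal (sqrt S)" "\<bar>v\<bar> \<noteq> \<infinity>"
    by (auto simp: ab)
qed

section \<open>Growth constants and distances to the solution set\<close>

lemma growth_constant_nonneg: "0 \<le> growth_constant X f"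
proof -
  have "ereal 0 \<le> growth_constant X f" unfolding growth_constant_def
    by (rule SUP_upper) (auto simp: opt_gap_nonneg simp flip: zero_ereal_def)
  then show ?thesis by (simp add: zero_ereal_def)
qed

lemma growth_constant_le:
  assumes "x \<in> X" "opt_gap X f x \<le> ereal G" "infdist x (opt_set X f) > 0"
  shows "growth_constant X f \<le> ereal (G / infdist x (opt_set X f))"
  unfolding growth_constant_def
proof (rule SUP_least)
  fix s assume "s \<in> {s. \<forall>x\<in>X. ereal (s * infdist x (opt_set X f)) \<le> opt_gap X f x}"
  then have "ereal (s * infdist x (opt_set X f)) \<le> ereal G"
    using assms(1,2) by (blast intro: order_trans)
  then show "ereal s \<le> ereal (G / infdist x (opt_set X f))"
    using assms(3) by (simp add: field_simps)
qed

text \<open>A positive distance together with the finite gap makes the growth constant finite. An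
  infinite growth constant, whose inverse is \<open>0\<close>, thus occurs only at distance
  zero.\<close>

lemma infdist_le_gap_over_growth:
  assumes x: "x \<in> X" and gap: "opt_gap X f x \<le> ereal G" and pos: "growth_constant X f > 0"
  shows "ereal (infdist x (opt_set X f)) \<le> ereal G * inverse (growth_constant X f)"
proof -
  have G: "0 \<le> G"
    using opt_gap_nonneg[OF x, of f] gap by (metis ereal_less_eq(5) order_trans)
  show ?thesis
  proof (cases "infdist x (opt_set X f) > 0")
    case True
    from growth_constant_le[OF x gap True] pos obtain g
      where g: "growth_constant X f = ereal g" "g > 0" "g \<le> G / infdist x (opt_set X f)"
      by (cases "growth_constant X f") auto
    then show ?thesis using True by (simp add: field_simps)
  next
    case False
    then have "infdist x (opt_set X f) = 0" using infdist_nonneg[of x "opt_set X f"] by linarith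
    then show ?thesis using G pos
      by (cases "growth_constant X f") (auto simp flip: zero_ereal_def)
  qed
qed

text \<open>Growth constant times distance is at most the gap, and \<open>\<Lambda>\<close> is at
  most \<open>r\<close> times the growth constant. The ratio enters squared because only its second
  moment is controlled.\<close>

lemma mult_infdist_le_ratio:
  assumes x: "x \<in> X" and gap: "opt_gap X f x \<le> ereal G" and r: "0 \<le> r"
    and ratio: "(ereal \<Lambda> / growth_constant X f)\<^sup>2 \<le> ereal (r\<^sup>2)"
  shows "\<Lambda> * infdist x (opt_set X f) \<le> r * G"
proof -
  have G: "0 \<le> G"
    using opt_gap_nonneg[OF x, of f] gap by (metis ereal_less_eq(5) order_trans)
  show ?thesis
  proof (cases "infdist x (opt_set X f) > 0")
    case True
    let ?D = "infdist x (opt_set X f)"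
    from growth_constant_le[OF x gap True] growth_constant_nonneg[of X f] obtain g
      where g: "growth_constant X f = ereal g" "0 \<le> g" "g \<le> G / ?D"
      by (cases "growth_constant X f") auto
    show ?thesis
    proof (cases "g = 0")
      case True
      \<comment> \<open>In \<open>ereal\<close> the inverse of \<open>0\<close> is
        \<open>\<infinity>\<close>, so a nonzero \<open>\<Lambda>\<close> would make the squared
        ratio infinite.\<close>
      have "\<Lambda> = 0" using ratio unfolding g True
        by (cases "\<Lambda> = 0") (auto simp: power2_eq_square divide_ereal_def simp flip: zero_ereal_def split: if_splits)
      then show ?thesis using r G by simp
    next
      case False
      then have g0: "g > 0" using g by simp
      have "(\<Lambda> / g)\<^sup>2 \<le> r\<^sup>2" using ratio False by (simp add: g power2_eq_square)
      then have "\<Lambda> / g \<le> r" using r by (rule power2_le_imp_le)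
      then have "\<Lambda> \<le> r * g" using g0 by (simp add: field_simps)
      then have "\<Lambda> * ?D \<le> r * g * ?D" using True by simp
      also have "\<dots> \<le> r * G"
        using g(3) True r mult_left_mono[of "g * ?D" G r] by (simp add: field_simps)
      finally show ?thesis .
    qed
  next
    case False
    then have "infdist x (opt_set X f) = 0" using infdist_nonneg[of x "opt_set X f"] by linarith
    then show ?thesis using G r by simp
  qed
qed

section \<open>Iteration counts and accumulated work\<close>

lemma enat_sqrt_nonneg: "0 \<le> enat_sqrt n"
  by (simp add: enat_sqrt_def split: enat.split)

lemma enat_sqrt_le_iff: "enat_sqrt n \<le> ereal y \<longleftrightarrow> (\<exists>k. n = enat k \<and> sqrt (real k) \<le> y)"
  by (cases n) (auto simp: enat_sqrt_def)

text \<open>The bound falls below \<open>e\<close> as soon as \<open>sqrt t\<close> reaches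
  \<open>R\<close>, so about \<open>R^2\<close> iterations suffice; rounding costs the summand
  \<open>1\<close>.\<close>

lemma enat_sqrt_iterations_needed_le:
  assumes gap: "\<And>t. t \<ge> 1 \<Longrightarrow> opt_gap X f (x t) \<le> ereal (R * e / sqrt (real t))"
    and e: "e > 0" and R: "R \<ge> 0"
  shows "enat_sqrt (iterations_needed X f e x) \<le> ereal (1 + R)"
proof -
  \<comment> \<open>The \<open>+ 1\<close> rounds up and also keeps \<open>n\<close> positive when
    \<open>R = 0\<close>, as an admissible iteration count must be.\<close>
  define n where "n = nat \<lfloor>R\<^sup>2\<rfloor> + 1"
  have n: "R\<^sup>2 \<le> real n" "real n \<le> R\<^sup>2 + 1" unfolding n_def by (simp_all) linarith+
  have "opt_gap X f (x t) \<le> ereal e" if "t \<ge> n" for t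
  proof -
    have t: "t \<ge> 1" using that by (simp add: n_def)
    have "R \<le> sqrt (real t)" using n that by (intro real_le_rsqrt) auto
    then have "R * e / sqrt (real t) \<le> e" using e t by (simp add: field_simps)
    then show ?thesis using gap[OF t] by (meson ereal_less_eq(3) order_trans)
  qed
  then have "iterations_needed X f e x \<le> enat n" unfolding iterations_needed_def
    by (intro Inf_lower imageI) (auto simp: n_def)
  then obtain k where k: "iterations_needed X f e x = enat k" "k \<le> n"
    by (cases "iterations_needed X f e x") auto
  have "sqrt (real k) \<le> 1 + R"
  proof (rule real_le_lsqrt)
    have "real k \<le> real n" using k by simp
    also have "\<dots> \<le> (1 + R)\<^sup>2" using n R by (simp add: power2_sum)
    finally show "real k \<le> (1 + R)\<^sup>2" .
  qed (use R in auto)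
  then show ?thesis by (simp add: k enat_sqrt_def)
qed

text \<open>Subadditivity of the square root; the induction carries along that the sum is
  finite.\<close>

lemma enat_sqrt_sum_le:
  fixes n :: "nat \<Rightarrow> enat"
  assumes "\<And>l. 1 \<le> l \<Longrightarrow> l \<le> L \<Longrightarrow> enat_sqrt (n l) \<le> ereal (y l)"
  shows "enat_sqrt (\<Sum>l = 1..L. n l * enat (m l)) \<le> ereal (\<Sum>l = 1..L. sqrt (real (m l)) * y l)"
  using assms
proof (induction L)
  case 0
  then show ?case by (simp add: enat_sqrt_def zero_enat_def)
next
  case (Suc L)
  from Suc obtain a where a: "(\<Sum>l = 1..L. n l * enat (m l)) = enat a"
    "sqrt (real a) \<le> (\<Sum>l = 1..L. sqrt (real (m l)) * y l)"
    unfolding enat_sqrt_le_iff by (metis le_SucI)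
  from Suc.prems[of "Suc L"] obtain k where k: "n (Suc L) = enat k" "sqrt (real k) \<le> y (Suc L)"
    unfolding enat_sqrt_le_iff by auto
  have "sqrt (real (a + k * m (Suc L))) \<le> sqrt (real a) + sqrt (real k * real (m (Suc L)))"
    using sqrt_add_le_add_sqrt[of "real a" "real k * real (m (Suc L))"] by simp
  also have "\<dots> = sqrt (real a) + sqrt (real (m (Suc L))) * sqrt (real k)"
    by (simp add: real_sqrt_mult mult.commute)
  also have "\<dots> \<le> (\<Sum>l = 1..L. sqrt (real (m l)) * y l) + sqrt (real (m (Suc L))) * y (Suc L)"
    using a k by (intro add_mono mult_left_mono) auto
  finally show ?case using a k by (simp add: enat_sqrt_def)
qed

text \<open>The roots grow at least by the factor \<open>sqrt c\<close>, so the last one dominates.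
  The constant is the sum of the geometric series with ratio \<open>1 / sqrt c\<close>, and it is
  the fixed point of \<open>k = k / sqrt c + 1\<close>, which drives the induction.\<close>

lemma sum_sqrt_geometric_le:
  fixes m :: "nat \<Rightarrow> nat"
  assumes c: "c > (1::real)" and m: "\<And>l. l \<ge> 2 \<Longrightarrow> c * real (m (l - 1)) \<le> real (m l)"
    and L: "L \<ge> 1"
  shows "(\<Sum>l = 1..L. sqrt (real (m l))) \<le> sqrt c / (sqrt c - 1) * sqrt (real (m L))"
  using L
proof (induction L rule: dec_induct)
  case base
  have "1 \<le> sqrt c / (sqrt c - 1)" using c by (simp add: field_simps)
  then have "1 * sqrt (real (m 1)) \<le> sqrt c / (sqrt c - 1) * sqrt (real (m 1))"
    by (intro mult_right_mono) auto
  then show ?case by simp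
next
  case (step L)
  have s: "sqrt c > 1" using c by simp
  have "sqrt c * sqrt (real (m L)) = sqrt (c * real (m L))" by (simp add: real_sqrt_mult)
  also have "\<dots> \<le> sqrt (real (m (Suc L)))" using m[of "Suc L"] step by simp
  finally have "(\<Sum>l = 1..L. sqrt (real (m l))) \<le> 1 / (sqrt c - 1) * sqrt (real (m (Suc L)))"
    using step.IH s by (simp add: field_simps)
  then have "(\<Sum>l = 1..Suc L. sqrt (real (m l)))
      \<le> (1 / (sqrt c - 1) + 1) * sqrt (real (m (Suc L)))"
    by (simp add: algebra_simps)
  also have "1 / (sqrt c - 1) + 1 = sqrt c / (sqrt c - 1)" using s by (simp add: field_simps)
  finally show ?case .
qed

section \<open>Expectations of extended-real functions\<close>

lemma ereal_expectation_nonneg: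
  assumes "AE \<omega> in M. 0 \<le> f \<omega>"
  shows "0 \<le> ereal_expectation M f"
proof -
  have "(\<integral>\<^sup>+\<omega>. e2ennreal (- f \<omega>) \<partial>M) = (\<integral>\<^sup>+\<omega>. 0 \<partial>M)"
    using assms by (intro nn_integral_cong_AE) (auto elim!: eventually_mono simp: e2ennreal_neg)
  then show ?thesis by (simp add: ereal_expectation_def zero_ennreal.rep_eq)
qed

text \<open>For a non-measurable \<open>f\<close>, such as the work, the integrals below are lower integrals, which are
  still monotone.\<close>

lemma ereal_expectation_le:
  assumes nonneg: "AE \<omega> in M. 0 \<le> f \<omega>" and le: "AE \<omega> in M. f \<omega> \<le> ereal (g \<omega>)"
    and g: "integrable M g" "integral\<^sup>L M g \<le> K"
  shows "ereal_expectation M f \<le> ereal K"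
proof -
  have g0: "AE \<omega> in M. 0 \<le> g \<omega>"
    using nonneg le by eventually_elim (metis ereal_less_eq(5) order_trans)
  then have K: "0 \<le> K" using integral_nonneg_AE[of g M] g(2) by linarith
  have "(\<integral>\<^sup>+\<omega>. e2ennreal (f \<omega>) \<partial>M) \<le> (\<integral>\<^sup>+\<omega>. ennreal (g \<omega>) \<partial>M)"
    using le by (intro nn_integral_mono_AE)
      (auto elim!: eventually_mono dest: e2ennreal_mono simp flip: e2ennreal_ereal)
  also have "\<dots> = ennreal (integral\<^sup>L M g)" using g(1) g0 by (rule nn_integral_eq_integral)
  also have "\<dots> \<le> ennreal K" using g(2) by (rule ennreal_leI)
  finally have "enn2ereal (\<integral>\<^sup>+\<omega>. e2ennreal (f \<omega>) \<partial>M) \<le> ereal K"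
    using K by (metis enn2ereal_ennreal less_eq_ennreal.rep_eq)
  moreover have "enn2ereal a - enn2ereal b \<le> enn2ereal a" for a b
    by (cases "enn2ereal a"; cases "enn2ereal b")
      (use enn2ereal_nonneg[of a] enn2ereal_nonneg[of b] in auto)
  ultimately show ?thesis unfolding ereal_expectation_def by (metis order_trans)
qed

text \<open>The tower property removes the conditioning, and a finite mean gives almost sure
  finiteness. This replaces an extended-real quantity by a real function fit for the Bochner
  integral.\<close>

lemma integrable_majorant_of_nn_cond_exp:
  fixes Z :: "'w \<Rightarrow> ereal"
  assumes M: "prob_space M" and F: "subalgebra M F" and Z: "Z \<in> borel_measurable M"
    and bound: "AE \<omega> in M. nn_cond_exp M F (\<lambda>\<omega>. e2ennreal (Z \<omega>)) \<omega> \<le> ennreal k"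
  shows "\<exists>z. integrable M z \<and> integral\<^sup>L M z \<le> \<bar>k\<bar> \<and> (\<forall>\<omega>. 0 \<le> z \<omega>)
           \<and> (AE \<omega> in M. Z \<omega> \<le> ereal (z \<omega>))"
proof -
  interpret prob_space M by (rule M)
  interpret finite_measure_subalgebra M F
    using F by unfold_locales
  let ?V = "\<lambda>\<omega>. e2ennreal (Z \<omega>)"
  have V: "?V \<in> borel_measurable M" using Z by measurable
  have "(\<integral>\<^sup>+\<omega>. ?V \<omega> \<partial>M) = (\<integral>\<^sup>+\<omega>. nn_cond_exp M F ?V \<omega> \<partial>M)"
    using nn_cond_exp_intg[of "\<lambda>_. 1" ?V] V by simp
  also have "\<dots> \<le> (\<integral>\<^sup>+\<omega>. ennreal k \<partial>M)" using bound by (rule nn_integral_mono_AE)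
  \<comment> \<open>A negative \<open>k\<close> is truncated to \<open>0\<close> by
    \<open>ennreal\<close>; the absolute value avoids a sign condition.\<close>
  also have "\<dots> \<le> ennreal \<bar>k\<bar>" by (simp add: emeasure_space_1 ennreal_leI)
  finally have int: "(\<integral>\<^sup>+\<omega>. ?V \<omega> \<partial>M) \<le> ennreal \<bar>k\<bar>" .
  then have fin: "AE \<omega> in M. ?V \<omega> \<noteq> \<infinity>"
    using V by (intro nn_integral_PInf_AE) (auto simp: top_unique)
  define z where "z = (\<lambda>\<omega>. enn2real (?V \<omega>))"
  have zm: "z \<in> borel_measurable M" unfolding z_def using V by measurable
  have eq: "(\<integral>\<^sup>+\<omega>. ennreal (z \<omega>) \<partial>M) = (\<integral>\<^sup>+\<omega>. ?V \<omega> \<partial>M)"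
    using fin by (intro nn_integral_cong_AE) (auto elim!: eventually_mono simp: z_def less_top)
  have z0: "\<forall>\<omega>. 0 \<le> z \<omega>" by (simp add: z_def)
  have zi: "integrable M z"
    using zm z0 int eq by (intro integrableI_nonneg) (auto intro: le_less_trans)
  have "ennreal (integral\<^sup>L M z) \<le> ennreal \<bar>k\<bar>"
    using int eq nn_integral_eq_integral[OF zi] z0 by simp
  then have "integral\<^sup>L M z \<le> \<bar>k\<bar>" by simp
  moreover have "AE \<omega> in M. Z \<omega> \<le> ereal (z \<omega>)"
    using fin
  proof eventually_elim
    case (elim \<omega>)
    then have "ereal (z \<omega>) = enn2ereal (?V \<omega>)"
      by (simp add: z_def less_top flip: enn2ereal_ennreal)
    then show ?case by (metis enn2ereal_e2ennreal enn2ereal_nonneg linear order_trans)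
  qed
  ultimately show ?thesis using zi z0 by blast
qed

text \<open>Turns a rate in \<open>s\<close>, the root of the sample size, into a rate in the
  expected root \<open>E\<close> of the work: \<open>C1 / s = C1 * C2 / (C2 * s)\<close>. If
  \<open>E = 0\<close>, then \<open>C1 * C2 / E\<close> is infinite. The factor \<open>k\<close> is
  \<open>1\<close> or the reciprocal of the growth constant.\<close>

lemma ereal_mult_divide_mono:
  fixes E k :: ereal
  assumes "0 \<le> E" "E \<le> ereal (C2 * s)" "C1 > 0" "C2 > 0" "s > 0" "0 \<le> k"
  shows "ereal (C1 / s) * k \<le> ereal (C1 * C2) * k / E"
proof -
  have "ereal (C1 / s) \<le> ereal (C1 * C2) / E"
  proof (cases "E = 0")
    case True
    then show ?thesis using assms by (simp add: divide_ereal_def flip: zero_ereal_def)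
  next
    case False
    then obtain e where e: "E = ereal e" "e > 0" "e \<le> C2 * s" using assms by (cases E) auto
    have "C1 * e \<le> C1 * (C2 * s)" using e assms by simp
    then show ?thesis using e assms by (simp add: field_simps)
  qed
  then have "ereal (C1 / s) * k \<le> ereal (C1 * C2) / E * k"
    using assms(6) by (rule ereal_mult_right_mono)
  then show ?thesis by (simp add: divide_ereal_def mult_ac)
qed

theorem theorem5p3:
  fixes A :: "real^'n1^'m1" and b :: "real^'m1" and c :: "real^'n1"
    and P :: "'s measure"
    and d :: "'s \<Rightarrow> real^'n2" and W :: "'s \<Rightarrow> real^'n2^'m2"
    and T :: "'s \<Rightarrow> real^'n1^'m2" and h :: "'s \<Rightarrow> real^'m2"
    and M :: "'w measure" and F :: "nat \<Rightarrow> 'w measure"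
    and \<xi> :: "nat \<Rightarrow> nat \<Rightarrow> 'w \<Rightarrow> 's"
    and m :: "nat \<Rightarrow> nat"
    and x0 :: "real^'n1"
    and xin :: "nat \<Rightarrow> nat \<Rightarrow> 'w \<Rightarrow> real^'n1"    \<comment> \<open>inner iterates\<close>
    and xout :: "nat \<Rightarrow> 'w \<Rightarrow> real^'n1"          \<comment> \<open>outputs of the outer iterations\<close>
    and gap_est :: "nat \<Rightarrow> nat \<Rightarrow> 'w \<Rightarrow> ereal"   \<comment> \<open>estimated optimality gaps\<close>
    and stop :: "nat \<Rightarrow> 'w \<Rightarrow> nat"              \<comment> \<open>stopping indices\<close>
    and \<Lambda> :: "nat \<Rightarrow> 'w \<Rightarrow> real"
    and \<nu> \<sigma>min \<sigma>max \<kappa>0 lam c1 :: real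
    and X :: "(real^'n1) set" and Q :: "real^'n1 \<Rightarrow> 's \<Rightarrow> ereal"
    and q obj :: "real^'n1 \<Rightarrow> ereal"
    and Qm :: "nat \<Rightarrow> nat \<Rightarrow> 'w \<Rightarrow> real^'n1 \<Rightarrow> ereal"
    and objm :: "nat \<Rightarrow> 'w \<Rightarrow> real^'n1 \<Rightarrow> ereal"
    and \<epsilon>in :: "nat \<Rightarrow> nat \<Rightarrow> 'w \<Rightarrow> real" and \<epsilon> :: "nat \<Rightarrow> 'w \<Rightarrow> real"
    and \<gamma> :: "nat \<Rightarrow> 'w \<Rightarrow> ereal" and \<gamma>0 :: ereal
    and N work :: "nat \<Rightarrow> 'w \<Rightarrow> enat"
  defines "X \<equiv> first_stage_feasible A b"
    and "Q \<equiv> recourse_value d W T h"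
    and "q \<equiv> (\<lambda>x. ereal_expectation P (\<lambda>s. Q x s))"
    and "obj \<equiv> (\<lambda>x. ereal (c \<bullet> x) + q x)"
    and "Qm \<equiv> (\<lambda>l k \<omega> x. sample_mean Q (\<lambda>j. \<xi> l j \<omega>) k x)"
    and "objm \<equiv> (\<lambda>l \<omega> x. ereal (c \<bullet> x) + Qm l (m l) \<omega> x)"
    and "\<epsilon>in \<equiv> (\<lambda>l t \<omega>. \<nu> / sqrt (real (m l)) *
                 closest_point {\<sigma>min..\<sigma>max} (sample_std Q (\<lambda>j. \<xi> l j \<omega>) (m l) (xin l t \<omega>)))"
    and "\<epsilon> \<equiv> (\<lambda>l \<omega>. \<epsilon>in l (stop l \<omega>) \<omega>)"
    and "\<gamma> \<equiv> (\<lambda>l \<omega>. growth_constant X (objm l \<omega>))"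
    and "N \<equiv> (\<lambda>l \<omega>. iterations_needed X (objm l \<omega>) (\<epsilon> l \<omega>) (\<lambda>t. xin l t \<omega>))"
    and "work \<equiv> (\<lambda>L \<omega>. \<Sum>l = 1..L. N l \<omega> * enat (m l))"
    and "\<gamma>0 \<equiv> growth_constant X obj"
    \<comment> \<open>the problem\<close>
  assumes P: "prob_space P"
    and data: "d \<in> borel_measurable P" "W \<in> borel_measurable P"
      "T \<in> borel_measurable P" "h \<in> borel_measurable P"
    and Q_bounded_below: "\<And>x s. x \<in> X \<Longrightarrow> s \<in> space P \<Longrightarrow> Q x s > -\<infinity>"
    \<comment> \<open>sampling\<close>
    and M: "prob_space M"
    and F: "filtration (space M) F" "\<And>l. subalgebra M (F l)"
    and scenarios: "\<And>l j. l \<ge> 1 \<Longrightarrow> j \<ge> 1 \<Longrightarrow> \<xi> l j \<in> measurable (F l) P"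
      "\<And>l j. l \<ge> 1 \<Longrightarrow> j \<ge> 1 \<Longrightarrow> distr M P (\<xi> l j) = P"
    and m_pos: "\<And>l. l \<ge> 1 \<Longrightarrow> m l \<ge> 1"
    \<comment> \<open>the algorithm\<close>
    and constants: "\<nu> > 0" "0 < \<sigma>min" "\<sigma>min < \<sigma>max"
    and x0: "x0 \<in> X" "\<And>\<omega>. \<omega> \<in> space M \<Longrightarrow> xout 0 \<omega> = x0"
    and xin: "\<And>l t \<omega>. l \<ge> 1 \<Longrightarrow> t \<ge> 1 \<Longrightarrow> \<omega> \<in> space M \<Longrightarrow> xin l t \<omega> \<in> X"
    and gap_est: "\<And>l. l \<ge> 1 \<Longrightarrow>
      AE \<omega> in M. \<forall>t\<ge>1. opt_gap X (objm l \<omega>) (xin l t \<omega>) \<le> gap_est l t \<omega>"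
    and stop: "\<And>l \<omega>. l \<ge> 1 \<Longrightarrow> \<omega> \<in> space M \<Longrightarrow> stop l \<omega> \<ge> 1"
      "\<And>l. l \<ge> 1 \<Longrightarrow> AE \<omega> in M. gap_est l (stop l \<omega>) \<omega> \<le> ereal (\<epsilon>in l (stop l \<omega>) \<omega>) \<and>
         (\<forall>t. 1 \<le> t \<and> t < stop l \<omega> \<longrightarrow> \<not> gap_est l t \<omega> \<le> ereal (\<epsilon>in l t \<omega>))"
    and xout: "\<And>l \<omega>. l \<ge> 1 \<Longrightarrow> \<omega> \<in> space M \<Longrightarrow> xout l \<omega> = xin l (stop l \<omega>) \<omega>"
      "\<And>l. l \<ge> 1 \<Longrightarrow> xout l \<in> borel_measurable (F l)"
    \<comment> \<open>(1)\<close>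
    and compact: "compact X"
    and complete_recourse: "\<And>x. x \<in> X \<Longrightarrow> AE s in P. second_stage_feasible W T h x s \<noteq> {}"
    \<comment> \<open>(2); the supremum over the uncountable set \<open>X\<close> is taken over suitable versions of the
        conditional variances, each of which is only determined almost everywhere\<close>
    and variance: "\<And>l j. l \<ge> 1 \<Longrightarrow> j \<ge> 1 \<Longrightarrow>
      \<exists>V. (\<forall>x\<in>X. V x \<in> borel_measurable (F (l - 1)) \<and>
             (AE \<omega> in M. V x \<omega> =
                cond_variance M (F (l - 1)) (\<lambda>\<omega>. real_of_ereal (Q x (\<xi> l j \<omega>))) \<omega>)) \<and>
          (AE \<omega> in M. (SUP x\<in>X. V x \<omega>) < \<infinity>)"
    and unif_error_measurable: "\<And>l k. l \<ge> 1 \<Longrightarrow> k \<ge> 1 \<Longrightarrow>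
      (\<lambda>\<omega>. SUP x\<in>X. \<bar>Qm l k \<omega> x - q x\<bar>\<^sup>2) \<in> borel_measurable M"
    and unif_error: "\<And>l k. l \<ge> 1 \<Longrightarrow> k \<ge> 1 \<Longrightarrow>
      AE \<omega> in M. nn_cond_exp M (F (l - 1))
        (\<lambda>\<omega>. e2ennreal (SUP x\<in>X. \<bar>Qm l k \<omega> x - q x\<bar>\<^sup>2)) \<omega> \<le> ennreal (\<kappa>0 / real k)"
    \<comment> \<open>(3)\<close>
    and \<Lambda>_measurable: "\<And>l. l \<ge> 1 \<Longrightarrow> \<Lambda> l \<in> borel_measurable (F l)"
    and \<gamma>_measurable: "\<And>l. l \<ge> 1 \<Longrightarrow> \<gamma> l \<in> borel_measurable M"
    and solver: "\<And>l. l \<ge> 1 \<Longrightarrow> AE \<omega> in M. \<forall>t\<ge>1. opt_gap X (objm l \<omega>) (xin l t \<omega>) \<le>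
      ereal (\<Lambda> l \<omega> * infdist (xout (l - 1) \<omega>) (opt_set X (objm l \<omega>)) / sqrt (real t))"
    and ratio: "\<And>l. l \<ge> 1 \<Longrightarrow>
      AE \<omega> in M. nn_cond_exp M (F (l - 1))
        (\<lambda>\<omega>. e2ennreal ((ereal (\<Lambda> l \<omega>) / \<gamma> l \<omega>)\<^sup>2)) \<omega> \<le> ennreal (lam\<^sup>2)"
    \<comment> \<open>(4); rounding up has no effect whenever \<open>c1 * m (l - 1)\<close> is an integer\<close>
    and c1: "c1 > 1"
    and geometric: "\<And>l. l \<ge> 2 \<Longrightarrow> int (m l) = \<lceil>c1 * real (m (l - 1))\<rceil>"
  shows "\<exists>\<tau>0::real.
      (\<forall>L\<ge>1. ereal_expectation M (\<lambda>\<omega>. obj (xout L \<omega>) - opt_value X obj)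
          \<le> ereal \<tau>0 / ereal_expectation M (\<lambda>\<omega>. enat_sqrt (work L \<omega>))) \<and>
      (\<gamma>0 > 0 \<longrightarrow>
        (\<forall>L\<ge>1. ereal_expectation M (\<lambda>\<omega>. ereal (infdist (xout L \<omega>) (opt_set X obj)))
          \<le> ereal \<tau>0 * inverse \<gamma>0 / ereal_expectation M (\<lambda>\<omega>. enat_sqrt (work L \<omega>))))"
proof -
  interpret prob_space M by (rule M)

  \<comment> \<open>Deterministic bounds on the tolerances\<close>
  define emin where "emin = \<nu> * \<sigma>min"
  define emax where "emax = \<nu> * \<sigma>max"
  have e_pos: "emin > 0" "emax > 0" using constants by (auto simp: emin_def emax_def)
  have m0: "real (m l) > 0" if "l \<ge> 1" for l using m_pos[OF that] by simp

  \<comment> \<open>The projection confines the estimated deviation to the interval, whatever the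
    sample.\<close>
  have eps: "emin / sqrt (real (m l)) \<le> \<epsilon> l \<omega>" "\<epsilon> l \<omega> \<le> emax / sqrt (real (m l))" for l \<omega>
  proof -
    have "closest_point {\<sigma>min..\<sigma>max} r \<in> {\<sigma>min..\<sigma>max}" for r
      using constants by (intro closest_point_in_set) auto
    then show "emin / sqrt (real (m l)) \<le> \<epsilon> l \<omega>" "\<epsilon> l \<omega> \<le> emax / sqrt (real (m l))"
      using constants
      by (auto simp: \<epsilon>_def \<epsilon>in_def emin_def emax_def intro!: divide_right_mono mult_left_mono)
  qed
  have eps_pos: "\<epsilon> l \<omega> > 0" if "l \<ge> 1" for l \<omega>
    using eps(1)[of l \<omega>] e_pos m0[OF that] by (meson divide_pos_pos less_le_trans real_sqrt_gt_zero)

  \<comment> \<open>Integrable majorants of the squared error and of the squared ratio\<close>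
  define majorant where "majorant = (\<lambda>f K z. integrable M z \<and> integral\<^sup>L M z \<le> \<bar>K\<bar> \<and> (\<forall>\<omega>. 0 \<le> z \<omega>)
    \<and> (AE \<omega> in M. (f \<omega> :: ereal) \<le> ereal (z \<omega>)))"
  have "\<exists>z. majorant (\<lambda>\<omega>. SUP x\<in>X. \<bar>Qm l (m l) \<omega> x - q x\<bar>\<^sup>2) (\<kappa>0 / real (m l)) z"
    if l: "l \<ge> 1" for l
    unfolding majorant_def
    using integrable_majorant_of_nn_cond_exp[OF M F(2)
      unif_error_measurable[OF l m_pos[OF l]] unif_error[OF l m_pos[OF l]]] .
  note Z_ex = this
  \<comment> \<open>One majorant is fixed per iteration because \<open>Z l\<close> reappears as the
    previous error in iteration \<open>l + 1\<close>.\<close>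
  define Z where "Z = (\<lambda>l. SOME z.
    majorant (\<lambda>\<omega>. SUP x\<in>X. \<bar>Qm l (m l) \<omega> x - q x\<bar>\<^sup>2) (\<kappa>0 / real (m l)) z)"
  have "majorant (\<lambda>\<omega>. SUP x\<in>X. \<bar>Qm l (m l) \<omega> x - q x\<bar>\<^sup>2) (\<kappa>0 / real (m l)) (Z l)"
    if "l \<ge> 1" for l
    unfolding Z_def by (rule someI_ex[OF Z_ex[OF that]])
  then have Z: "\<And>l. l \<ge> 1 \<Longrightarrow> integrable M (Z l)"
      "\<And>l. l \<ge> 1 \<Longrightarrow> integral\<^sup>L M (Z l) \<le> \<bar>\<kappa>0 / real (m l)\<bar>" "\<And>l \<omega>. l \<ge> 1 \<Longrightarrow> 0 \<le> Z l \<omega>"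
      "\<And>l. l \<ge> 1 \<Longrightarrow> AE \<omega> in M. (SUP x\<in>X. \<bar>Qm l (m l) \<omega> x - q x\<bar>\<^sup>2) \<le> ereal (Z l \<omega>)"
    unfolding majorant_def by blast+
  have "\<exists>z. majorant (\<lambda>\<omega>. (ereal (\<Lambda> l \<omega>) / \<gamma> l \<omega>)\<^sup>2) (lam\<^sup>2) z" if l: "l \<ge> 1" for l
  proof -
    have [measurable]: "\<Lambda> l \<in> borel_measurable M"
      using measurable_from_subalg[OF F(2) \<Lambda>_measurable[OF l]] .
    note \<gamma>_measurable[OF l, measurable]
    have "(\<lambda>\<omega>. (ereal (\<Lambda> l \<omega>) / \<gamma> l \<omega>)\<^sup>2) \<in> borel_measurable M"
      unfolding power2_eq_square by measurable
    from integrable_majorant_of_nn_cond_exp[OF M F(2) this ratio[OF l]] show ?thesis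
      unfolding majorant_def .
  qed
  note U_ex = this
  define U where "U = (\<lambda>l. SOME z. majorant (\<lambda>\<omega>. (ereal (\<Lambda> l \<omega>) / \<gamma> l \<omega>)\<^sup>2) (lam\<^sup>2) z)"
  have "majorant (\<lambda>\<omega>. (ereal (\<Lambda> l \<omega>) / \<gamma> l \<omega>)\<^sup>2) (lam\<^sup>2) (U l)" if "l \<ge> 1" for l
    unfolding U_def by (rule someI_ex[OF U_ex[OF that]])
  then have U: "\<And>l. l \<ge> 1 \<Longrightarrow> integrable M (U l)"
      "\<And>l. l \<ge> 1 \<Longrightarrow> integral\<^sup>L M (U l) \<le> lam\<^sup>2" "\<And>l \<omega>. l \<ge> 1 \<Longrightarrow> 0 \<le> U l \<omega>"
      "\<And>l. l \<ge> 1 \<Longrightarrow> AE \<omega> in M. (ereal (\<Lambda> l \<omega>) / \<gamma> l \<omega>)\<^sup>2 \<le> ereal (U l \<omega>)"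
    unfolding majorant_def abs_power2 by blast+

  \<comment> \<open>Closeness of the objectives and finiteness of the initial gap\<close>
  have close: "AE \<omega> in M. \<forall>x\<in>X. \<bar>objm l \<omega> x - obj x\<bar> \<le> ereal (sqrt (Z l \<omega>))
      \<and> \<bar>obj x - objm l \<omega> x\<bar> \<le> ereal (sqrt (Z l \<omega>)) \<and> \<bar>q x\<bar> \<noteq> \<infinity>" if "l \<ge> 1" for l
    using Z(4)[OF that]
  proof eventually_elim
    case (elim \<omega>)
    then have "\<bar>Qm l (m l) \<omega> x - q x\<bar>\<^sup>2 \<le> ereal (Z l \<omega>)" if "x \<in> X" for x
      using that by (meson SUP_upper order_trans)
    note bounds = abs_diff_le_sqrt_ereal[OF this]
    show ?case unfolding objm_def obj_def by (intro ballI conjI bounds)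
  qed

  text \<open>The solver condition is what makes the optimal value of the true problem finite.\<close>
  have "AE \<omega> in M. \<exists>g. opt_gap X obj x0 \<le> ereal g"
    using close[OF order_refl] solver[OF order_refl] AE_space
  proof eventually_elim
    case (elim \<omega>)
    have x: "xin 1 1 \<omega> \<in> X" using xin elim by simp
    \<comment> \<open>One inner iterate of the first outer iteration suffices: its sampled gap is
      finite, hence so is its true gap, and finite objective values move this to
      \<open>x0\<close>.\<close>
    note gap1 = elim(2)[rule_format, of 1, OF order_refl]
    have "\<bar>obj x - objm 1 \<omega> x\<bar> \<le> ereal (sqrt (Z 1 \<omega>))" if "x \<in> X" for x
      using elim(1) that by blast
    note gap2 = opt_gap_perturb[OF x this gap1]
    have "\<bar>obj y\<bar> \<noteq> \<infinity>" if "y \<in> X" for y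
      using elim(1) that unfolding obj_def by (cases "q y") auto
    from opt_gap_finite_transfer[OF x x0(1) this[OF x] this[OF x0(1)] gap2] show ?case .
  qed
  \<comment> \<open>The claim does not depend on \<open>\<omega>\<close>, so on a probability space
    it holds outright.\<close>
  then have "\<exists>g. opt_gap X obj x0 \<le> ereal g" unfolding AE_const .
  then obtain g0 where g0: "opt_gap X obj x0 \<le> ereal g0" ..

  \<comment> \<open>True optimality gaps of the outer iterates\<close>
  define a where "a = (\<lambda>l. if l = 0 then g0 else emax / sqrt (real (m l)))"
  \<comment> \<open>At index \<open>0\<close> the point \<open>x0\<close> has the deterministic gap
    bound \<open>g0\<close> and no sampling error, so one formula covers all starting
    points.\<close>
  define z where "z = (\<lambda>l. if l = 0 then \<lambda>_. 0 else Z l)"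
  have z: "integrable M (z l)" "0 \<le> z l \<omega>" for l \<omega>
    using Z(1,3)[of l] by (cases "l = 0"; simp add: z_def)+
  have z_int: "real (m l) * integral\<^sup>L M (z l) \<le> \<bar>\<kappa>0\<bar>" for l
  proof (cases "l = 0")
    case False
    then show ?thesis using Z(2)[of l] m0[of l] by (simp add: z_def field_simps)
  qed (simp add: z_def)

  have xoutX: "xout l \<omega> \<in> X" if "\<omega> \<in> space M" for l \<omega>
    using x0 xin xout(1) stop(1) that by (cases "l = 0") auto

  have gap: "AE \<omega> in M. opt_gap X obj (xout l \<omega>) \<le> ereal (a l + 2 * sqrt (z l \<omega>))" for l
  proof (cases "l = 0")
    case True
    show ?thesis using AE_space
      by eventually_elim (use True g0 x0 in \<open>simp add: a_def z_def\<close>)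
  next
    case False
    then have l: "l \<ge> 1" by simp
    show ?thesis using close[OF l] gap_est[OF l] stop(2)[OF l] AE_space
    proof eventually_elim
      case (elim \<omega>)
      have "opt_gap X (objm l \<omega>) (xout l \<omega>) \<le> gap_est l (stop l \<omega>) \<omega>"
        using elim stop(1) xout(1) l by simp
      also have "\<dots> \<le> ereal (\<epsilon> l \<omega>)" using elim by (simp add: \<epsilon>_def)
      also have "\<dots> \<le> ereal (a l)" using eps l by (simp add: a_def)
      finally have "opt_gap X obj (xout l \<omega>) \<le> ereal (a l + 2 * sqrt (Z l \<omega>))"
        using elim xoutX by (intro opt_gap_perturb[where g = "objm l \<omega>"]) auto
      then show ?case using l by (simp add: z_def)
    qed
  qed

  \<comment> \<open>The number of inner iterations\<close>
  define Y where "Y = (\<lambda>l \<omega>. 1 + (U l \<omega> + real (m l) *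
    (3 * ((a (l - 1))\<^sup>2 + 4 * z (l - 1) \<omega> + 4 * z l \<omega>))) / (2 * emin))"
  \<comment> \<open>In \<open>Y l\<close> the \<open>3\<close> comes from squaring a sum of three
    terms, the \<open>4\<close> from squaring \<open>2 * sqrt z\<close>, and \<open>2 * emin\<close>
    from the split of the product and the lower bound on the tolerance.\<close>
  have NY: "AE \<omega> in M. enat_sqrt (N l \<omega>) \<le> ereal (Y l \<omega>)" if l: "l \<ge> 1" for l
    using close[OF l] gap[of "l - 1"] U(4)[OF l] solver[OF l] AE_space
  proof eventually_elim
    case (elim \<omega>)
    \<comment> \<open>The first two terms bound the true gap of the starting point; the last is the
      cost of passing to the new sampled problem.\<close>
    define G where "G = a (l - 1) + 2 * sqrt (z (l - 1) \<omega>) + 2 * sqrt (z l \<omega>)"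
    define r where "r = sqrt (U l \<omega>)"
    have r: "0 \<le> r" "r\<^sup>2 = U l \<omega>" using U(3)[OF l] by (auto simp: r_def)
    have xX: "xout (l - 1) \<omega> \<in> X" using elim xoutX by simp
    have "\<bar>objm l \<omega> y - obj y\<bar> \<le> ereal (sqrt (z l \<omega>))" if "y \<in> X" for y
      using elim(1) that l by (simp add: z_def)
    note gapG = opt_gap_perturb[OF xX this elim(2), folded G_def]
    then have G: "0 \<le> G"
      using opt_gap_nonneg[OF xX, of "objm l \<omega>"] by (metis ereal_less_eq(5) order_trans)
    have dist: "\<Lambda> l \<omega> * infdist (xout (l - 1) \<omega>) (opt_set X (objm l \<omega>)) \<le> r * G"
      using mult_infdist_le_ratio[OF xX gapG r(1)] elim r by (simp add: \<gamma>_def)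
    define R where "R = r * G / \<epsilon> l \<omega>"
    have R: "0 \<le> R" "R * \<epsilon> l \<omega> = r * G" using r G eps_pos[OF l, of \<omega>] by (auto simp: R_def)
    have "enat_sqrt (N l \<omega>) \<le> ereal (1 + R)" unfolding N_def
    proof (rule enat_sqrt_iterations_needed_le)
      fix t :: nat assume t: "t \<ge> 1"
      have "opt_gap X (objm l \<omega>) (xin l t \<omega>) \<le>
          ereal (\<Lambda> l \<omega> * infdist (xout (l - 1) \<omega>) (opt_set X (objm l \<omega>)) / sqrt (real t))"
        using elim t by blast
      also have "\<dots> \<le> ereal (R * \<epsilon> l \<omega> / sqrt (real t))"
        using dist R by (simp add: divide_right_mono)
      finally show "opt_gap X (objm l \<omega>) (xin l t \<omega>) \<le> ereal (R * \<epsilon> l \<omega> / sqrt (real t))" .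
    qed (use R eps_pos[OF l] in auto)
    also have "1 + R \<le> Y l \<omega>"
    proof -
      have "R \<le> r * G / (emin / sqrt (real (m l)))" unfolding R_def
        using eps(1)[of l \<omega>] eps_pos[OF l, of \<omega>] e_pos m0[OF l] r G
        by (intro divide_left_mono) (auto intro!: mult_pos_pos divide_pos_pos)
      also have "\<dots> = r * (sqrt (real (m l)) * G) / emin" by simp
      \<comment> \<open>Weighting \<open>G\<close> by \<open>sqrt (m l)\<close> balances the split:
        \<open>r^2\<close> and \<open>m l * G^2\<close> both have means bounded uniformly in
        \<open>l\<close>.\<close>
      also have "\<dots> \<le> ((r\<^sup>2 + real (m l) * G\<^sup>2) / 2) / emin"
        using sum_squares_bound[of r "sqrt (real (m l)) * G"] e_pos
        by (intro divide_right_mono) (auto simp: power_mult_distrib)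
      also have "\<dots> = (U l \<omega> + real (m l) * G\<^sup>2) / (2 * emin)" using r by simp
      also have "\<dots> \<le> (U l \<omega> + real (m l) *
          (3 * ((a (l - 1))\<^sup>2 + 4 * z (l - 1) \<omega> + 4 * z l \<omega>))) / (2 * emin)"
      proof -
        have sq3: "(u + v + w)\<^sup>2 \<le> 3 * (u\<^sup>2 + v\<^sup>2 + w\<^sup>2)" for u v w :: real
          using sum_squares_bound[of u v] sum_squares_bound[of u w] sum_squares_bound[of v w]
          by (simp add: power2_eq_square algebra_simps)
        have "G\<^sup>2 \<le> 3 * ((a (l - 1))\<^sup>2 + 4 * z (l - 1) \<omega> + 4 * z l \<omega>)"
          using sq3[of "a (l - 1)" "2 * sqrt (z (l - 1) \<omega>)" "2 * sqrt (z l \<omega>)"] z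
          by (simp add: G_def power_mult_distrib)
        then show ?thesis using e_pos by (intro divide_right_mono add_left_mono mult_left_mono) auto
      qed
      finally show ?thesis by (simp add: Y_def)
    qed
    finally show ?case by simp
  qed

  \<comment> \<open>A uniform bound on the mean of \<open>Y l\<close>\<close>
  have m_ge: "c1 * real (m (l - 1)) \<le> real (m l)" and
      m_le: "real (m l) \<le> (c1 + 1) * real (m (l - 1))" if "l \<ge> 2" for l
  proof -
    have eq: "real (m l) = real_of_int \<lceil>c1 * real (m (l - 1))\<rceil>"
      using geometric[OF that] by (metis of_int_of_nat_eq)
    show "c1 * real (m (l - 1)) \<le> real (m l)" unfolding eq by simp
    \<comment> \<open>Rounding up adds at most \<open>1\<close>, which \<open>m (l - 1)\<close>
      absorbs.\<close>
    have "real (m l) \<le> c1 * real (m (l - 1)) + 1" unfolding eq by linarith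
    moreover have "1 \<le> real (m (l - 1))" using m_pos[of "l - 1"] that by simp
    ultimately show "real (m l) \<le> (c1 + 1) * real (m (l - 1))" by (simp add: algebra_simps)
  qed
  \<comment> \<open>The first summand covers \<open>l = 1\<close>, where \<open>a 0 = g0\<close>;
    the second covers later iterations, where consecutive sample sizes differ by a factor of at most
    \<open>c1 + 1\<close>.\<close>
  define Ka where "Ka = real (m 1) * g0\<^sup>2 + (c1 + 1) * emax\<^sup>2"
  have Ka: "real (m l) * (a (l - 1))\<^sup>2 \<le> Ka" if l: "l \<ge> 1" for l
  proof (cases "l = 1")
    case True
    then show ?thesis using c1 by (simp add: a_def Ka_def)
  next
    case False
    then have l2: "l \<ge> 2" using l by simp
    have pos: "real (m (l - 1)) > 0" using m0 l2 by simp
    have "real (m l) * (a (l - 1))\<^sup>2 = real (m l) * emax\<^sup>2 / real (m (l - 1))"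
      using l2 by (simp add: a_def power_divide)
    also have "\<dots> \<le> (c1 + 1) * real (m (l - 1)) * emax\<^sup>2 / real (m (l - 1))"
      using m_le[OF l2] by (intro divide_right_mono mult_right_mono) auto
    also have "\<dots> \<le> Ka" using pos by (simp add: Ka_def)
    finally show ?thesis .
  qed
  have Kz: "real (m l) * integral\<^sup>L M (z (l - 1)) \<le> (c1 + 1) * \<bar>\<kappa>0\<bar>" if l: "l \<ge> 1" for l
  proof (cases "l = 1")
    case True
    then show ?thesis using c1 by (simp add: z_def)
  next
    case False
    then have l2: "l \<ge> 2" using l by simp
    have "real (m l) * integral\<^sup>L M (z (l - 1))
        \<le> (c1 + 1) * real (m (l - 1)) * integral\<^sup>L M (z (l - 1))"
      using m_le[OF l2] z by (intro mult_right_mono integral_nonneg_AE) auto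
    also have "\<dots> = (c1 + 1) * (real (m (l - 1)) * integral\<^sup>L M (z (l - 1)))" by simp
    also have "\<dots> \<le> (c1 + 1) * \<bar>\<kappa>0\<bar>" using z_int c1 by (intro mult_left_mono) auto
    finally show ?thesis .
  qed
  define K where "K = 1 + (lam\<^sup>2 + 3 * (Ka + 4 * ((c1 + 1) * \<bar>\<kappa>0\<bar>) + 4 * \<bar>\<kappa>0\<bar>)) / (2 * emin)"
  have Ka0: "Ka \<ge> 0" using c1 by (simp add: Ka_def)
  then have K_pos: "K > 0" using c1 e_pos unfolding K_def
    by (intro add_pos_nonneg divide_nonneg_pos add_nonneg_nonneg mult_nonneg_nonneg) auto
  have Y_int: "integrable M (Y l)" if "l \<ge> 1" for l
    unfolding Y_def using U(1)[OF that] z by simp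
  have Y_le: "integral\<^sup>L M (Y l) \<le> K" if l: "l \<ge> 1" for l
  proof -
    have "integral\<^sup>L M (Y l) = 1 + (integral\<^sup>L M (U l) + 3 * (real (m l) * (a (l - 1))\<^sup>2
        + 4 * (real (m l) * integral\<^sup>L M (z (l - 1))) + 4 * (real (m l) * integral\<^sup>L M (z l)))) / (2 * emin)"
      unfolding Y_def using U(1)[OF l] z by (simp add: prob_space algebra_simps)
    also have "\<dots> \<le> K" unfolding K_def
      using U(2)[OF l] Ka[OF l] Kz[OF l] z_int[of l] e_pos
      by (intro add_mono divide_right_mono mult_left_mono) auto
    finally show ?thesis .
  qed

  \<comment> \<open>The expected gap is at most \<open>C1 / sqrt (m L)\<close> and the expected root
    of the work at most \<open>C2 * sqrt (m L)\<close>; the sample size cancels in the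
    product.\<close>
  define C1 where "C1 = emax + \<bar>\<kappa>0\<bar> + 1"
  define C2 where "C2 = K * (sqrt c1 / (sqrt c1 - 1))"
  have C1: "C1 > 0" using e_pos by (simp add: C1_def)
  have C2: "C2 > 0" using K_pos c1 by (simp add: C2_def)

  \<comment> \<open>The expected square root of the work\<close>
  have work_nonneg: "0 \<le> ereal_expectation M (\<lambda>\<omega>. enat_sqrt (work L \<omega>))" for L
    by (intro ereal_expectation_nonneg) (simp add: enat_sqrt_nonneg)
  have work_le: "ereal_expectation M (\<lambda>\<omega>. enat_sqrt (work L \<omega>)) \<le> ereal (C2 * sqrt (real (m L)))"
    if L: "L \<ge> 1" for L
  proof (rule ereal_expectation_le)
    have "AE \<omega> in M. \<forall>l. l \<ge> 1 \<longrightarrow> enat_sqrt (N l \<omega>) \<le> ereal (Y l \<omega>)"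
      using NY by (simp add: AE_all_countable)
    then show "AE \<omega> in M. enat_sqrt (work L \<omega>) \<le> ereal (\<Sum>l = 1..L. sqrt (real (m l)) * Y l \<omega>)"
      unfolding work_def by eventually_elim (rule enat_sqrt_sum_le, blast)
    show "integrable M (\<lambda>\<omega>. \<Sum>l = 1..L. sqrt (real (m l)) * Y l \<omega>)"
      using Y_int by (intro Bochner_Integration.integrable_sum integrable_mult_right) auto
    have "(\<integral>\<omega>. (\<Sum>l = 1..L. sqrt (real (m l)) * Y l \<omega>) \<partial>M)
        = (\<Sum>l = 1..L. sqrt (real (m l)) * integral\<^sup>L M (Y l))"
      using Y_int by (subst Bochner_Integration.integral_sum) auto
    also have "\<dots> \<le> (\<Sum>l = 1..L. sqrt (real (m l)) * K)"
      using Y_le by (intro sum_mono mult_left_mono) auto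
    also have "\<dots> = K * (\<Sum>l = 1..L. sqrt (real (m l)))" by (simp add: sum_distrib_left mult.commute)
    also have "\<dots> \<le> K * (sqrt c1 / (sqrt c1 - 1) * sqrt (real (m L)))"
      using sum_sqrt_geometric_le[of c1 m, OF c1 m_ge L] K_pos by (intro mult_left_mono) auto
    finally show "(\<integral>\<omega>. (\<Sum>l = 1..L. sqrt (real (m l)) * Y l \<omega>) \<partial>M) \<le> C2 * sqrt (real (m L))"
      by (simp add: C2_def)
  qed (simp add: enat_sqrt_nonneg)

  \<comment> \<open>The expected optimality gap of the output\<close>
  define B where "B = (\<lambda>L \<omega>. (emax + 1) / sqrt (real (m L)) + sqrt (real (m L)) * z L \<omega>)"
  have B_int: "integrable M (B L)" for L unfolding B_def using z by simp
  have B_le: "integral\<^sup>L M (B L) \<le> C1 / sqrt (real (m L))" if L: "L \<ge> 1" for L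
  proof -
    have "integral\<^sup>L M (B L) = (emax + 1) / sqrt (real (m L))
        + (real (m L) * integral\<^sup>L M (z L)) / sqrt (real (m L))"
      unfolding B_def using z m0[OF L] by (simp add: prob_space field_simps)
    also have "\<dots> \<le> (emax + 1) / sqrt (real (m L)) + \<bar>\<kappa>0\<bar> / sqrt (real (m L))"
      using z_int[of L] by (intro add_left_mono divide_right_mono) auto
    finally show ?thesis by (simp add: C1_def add_divide_distrib)
  qed
  have gapB: "AE \<omega> in M. opt_gap X obj (xout L \<omega>) \<le> ereal (B L \<omega>)" if L: "L \<ge> 1" for L
    using gap[of L]
  proof eventually_elim
    case (elim \<omega>)
    \<comment> \<open>The weight \<open>sqrt (m L)\<close> in this split makes the bound affine in
      \<open>z L\<close>, so the first moment of \<open>z L\<close> yields the order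
      \<open>1 / sqrt (m L)\<close>.\<close>
    have "2 * sqrt (z L \<omega>) \<le> 1 / sqrt (real (m L)) + sqrt (real (m L)) * z L \<omega>"
    proof -
      have "2 * (sqrt (real (m L)) * sqrt (z L \<omega>)) \<le> 1 + real (m L) * z L \<omega>"
        using sum_squares_bound[of 1 "sqrt (real (m L)) * sqrt (z L \<omega>)"] z
        by (simp add: power_mult_distrib)
      then show ?thesis using m0[OF L] by (simp add: field_simps)
    qed
    then have "a L + 2 * sqrt (z L \<omega>) \<le> B L \<omega>"
      using L by (simp add: a_def B_def add_divide_distrib)
    then show ?case using elim by (meson ereal_less_eq(3) order_trans)
  qed
  have gap_nonneg: "AE \<omega> in M. 0 \<le> opt_gap X obj (xout L \<omega>)" for L
    using xoutX by (intro AE_I2 opt_gap_nonneg)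

  \<comment> \<open>Both rates with the common constant \<open>C1 * C2\<close>\<close>
  show ?thesis
  proof (intro exI[of _ "C1 * C2"] conjI allI impI)
    fix L :: nat assume L: "L \<ge> 1"
    have "ereal_expectation M (\<lambda>\<omega>. opt_gap X obj (xout L \<omega>)) \<le> ereal (C1 / sqrt (real (m L)))"
      by (rule ereal_expectation_le[OF gap_nonneg gapB[OF L] B_int B_le[OF L]])
    also have "\<dots> \<le> ereal (C1 * C2) / ereal_expectation M (\<lambda>\<omega>. enat_sqrt (work L \<omega>))"
      using ereal_mult_divide_mono[OF work_nonneg work_le[OF L] C1 C2, of 1] m0[OF L] by simp
    finally show "ereal_expectation M (\<lambda>\<omega>. obj (xout L \<omega>) - opt_value X obj)
        \<le> ereal (C1 * C2) / ereal_expectation M (\<lambda>\<omega>. enat_sqrt (work L \<omega>))"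
      by (simp add: opt_gap_def)
  next
    fix L :: nat assume g: "\<gamma>0 > 0" and L: "L \<ge> 1"
    \<comment> \<open>The case \<open>\<gamma>0 = \<infinity>\<close> is included, with
      \<open>k = 0\<close>.\<close>
    obtain k where k: "inverse \<gamma>0 = ereal k" "k \<ge> 0" using g by (cases \<gamma>0) auto
    have "ereal_expectation M (\<lambda>\<omega>. ereal (infdist (xout L \<omega>) (opt_set X obj)))
        \<le> ereal (C1 / sqrt (real (m L)) * k)"
    proof (rule ereal_expectation_le)
      show "AE \<omega> in M. ereal (infdist (xout L \<omega>) (opt_set X obj)) \<le> ereal (B L \<omega> * k)"
        using gapB[OF L] AE_space
      proof eventually_elim
        case (elim \<omega>)
        then show ?case
          using infdist_le_gap_over_growth[OF xoutX, of \<omega> obj L] g k unfolding \<gamma>0_def by simp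
      qed
      show "integrable M (\<lambda>\<omega>. B L \<omega> * k)" using B_int by simp
      show "(\<integral>\<omega>. B L \<omega> * k \<partial>M) \<le> C1 / sqrt (real (m L)) * k"
        using mult_right_mono[OF B_le[OF L] k(2)] by simp
    qed (simp add: infdist_nonneg)
    also have "\<dots> = ereal (C1 / sqrt (real (m L))) * inverse \<gamma>0" by (simp add: k)
    also have "\<dots> \<le> ereal (C1 * C2) * inverse \<gamma>0
        / ereal_expectation M (\<lambda>\<omega>. enat_sqrt (work L \<omega>))"
      using m0[OF L] k by (intro ereal_mult_divide_mono[OF work_nonneg work_le[OF L] C1 C2]) auto
    finally show "ereal_expectation M (\<lambda>\<omega>. ereal (infdist (xout L \<omega>) (opt_set X obj)))
        \<le> ereal (C1 * C2) * inverse \<gamma>0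
          / ereal_expectation M (\<lambda>\<omega>. enat_sqrt (work L \<omega>))" .
  qed
qed

end
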